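(* Let $k$ be a real closed field with algebraic closure $K$, and let $\lambda,\mu\in K$ be non-zero elements. The following formulae hold: \begin{enumerate} \item $J_\lambda(1)\otimes J_\mu(1)\sim J_{\lambda\mu}(1)$ if $\lambda,\mu\in k$; \item $J_\lambda(1)\otimes R_\mu\sim R_{\lambda\mu}$ if $\lambda\in k$, $\mu\in K\setminus k$. \end{enumerate} Suppose $\lambda,\mu\notin k$. Then \begin{enumerate} \item[3.] $R_\lambda\otimes R_\mu\sim 2J_{\lambda\mu}(1)\oplus 2J_{-\lambda\mu}(1)$ if $\lambda,\mu\in\operatorname{span}_k\{i\}$; \item[4.] $R_\lambda\otimes R_\mu\sim 2J_{\lambda\mu}(1)\oplus R_{\bar\lambda\mu}$ if $\lambda,\mu\notin\operatorname{span}_k\{i\}$ and $\bar\lambda=r\mu$ for some $r\in k$; \item[5.] $R_\lambda\otimes R_\mu\sim 2J_{\bar\lambda\mu}(1)\oplus R_{\lambda\mu}$ if $\lambda,\mu\notin\operatorname{span}_k\{i\}$ and $\lambda=r\mu$ for some $r\in k$; \item[6.] $R_\lambda\otimes R_\mu\sim R_{\lambda\mu}\oplus R_{\bar\lambda\mu}$ otherwise. \end{enumerate}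
   Context: A field $k$ is real closed if it has index two in its algebraic closure $K$; then $k$ has characteristic zero and $K=k(i)$, where $i\in K$ is a fixed square root of $-1$. The map $\lambda\mapsto\bar\lambda$ denotes the non-trivial automorphism of $K$ over $k$. For $\lambda\in k$, $J_\lambda(1)$ is the $1\times1$ matrix $(\lambda)$. For $\lambda=a+bi\in K\setminus k$ with $a,b\in k$, $R_\lambda=\begin{pmatrix}a&-b\\ b&a\end{pmatrix}\in k^{2\times2}$. The symbol $\otimes$ denotes the Kronecker product of matrices, $\oplus$ the block-diagonal direct sum, $nA$ the direct sum of $n$ copies of $A$, and $A\sim B$ means $A=TBT^{-1}$ for some invertible matrix $T$ over $k$. *)

theory Defs
  imports
    "HOL-Computational_Algebra.Polynomial"
    "Jordan_Normal_Form.Matrix"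
begin

text \<open>
  A field \<open>k\<close> and an algebraic closure \<open>K\<close> of it are given by two types and an embedding
  \<open>emb\<close>; the subfield \<open>k \<subseteq> K\<close> is \<open>range emb\<close>. Algebraic closedness of \<open>K\<close> is the class
  constraint.
\<close>

definition is_algebraic_closure :: "('k::field \<Rightarrow> 'K::alg_closed_field) \<Rightarrow> bool" where
  "is_algebraic_closure emb \<longleftrightarrow>
     field_hom emb \<and> (\<forall>z. \<exists>p. p \<noteq> 0 \<and> poly (map_poly emb p) z = 0)"

definition scale_by :: "('k \<Rightarrow> 'K) \<Rightarrow> 'k \<Rightarrow> 'K \<Rightarrow> 'K::times" where
  "scale_by emb c z = emb c * z"

text \<open>
  The library sets \<open>dim\<close> to 0 for spaces without a finite basis, so \<open>dim = 2\<close> does mean that the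
  index \<open>[K : k]\<close> is finite and equal to two.
\<close>

definition real_closed_with_closure :: "('k::field \<Rightarrow> 'K::alg_closed_field) \<Rightarrow> bool" where
  "real_closed_with_closure emb \<longleftrightarrow>
     is_algebraic_closure emb \<and> vector_space.dim (scale_by emb) UNIV = 2"

definition automorphism_over :: "('k::field \<Rightarrow> 'K::field) \<Rightarrow> ('K \<Rightarrow> 'K) \<Rightarrow> bool" where
  "automorphism_over emb \<sigma> \<longleftrightarrow> field_hom \<sigma> \<and> bij \<sigma> \<and> (\<forall>a. \<sigma> (emb a) = emb a)"

definition conj_over :: "('k::field \<Rightarrow> 'K::field) \<Rightarrow> 'K \<Rightarrow> 'K" where
  "conj_over emb = (THE \<sigma>. automorphism_over emb \<sigma> \<and> \<sigma> \<noteq> id)"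

text \<open>
  Matrices over \<open>k\<close> have entries of type \<open>'k\<close>, while they are indexed by elements of \<open>K\<close>.
  \<open>J_mat emb z\<close> is meaningful only for \<open>z \<in> range emb\<close>. \<open>R_mat emb i z\<close> takes the coordinates
  \<open>z = a + b i\<close>, which exist and are unique for a real closed \<open>k\<close> and \<open>i\<^sup>2 = -1\<close>.
\<close>

definition J_mat :: "('k \<Rightarrow> 'K) \<Rightarrow> 'K \<Rightarrow> 'k mat" where
  "J_mat emb z = mat_of_rows_list 1 [[inv_into UNIV emb z]]"

definition R_mat :: "('k::field \<Rightarrow> 'K::field) \<Rightarrow> 'K \<Rightarrow> 'K \<Rightarrow> 'k mat" where
  "R_mat emb i z =
     (let (a, b) = (THE (a, b). z = emb a + emb b * i)
      in mat_of_rows_list 2 [[a, -b], [b, a]])"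

definition kronecker :: "'a::times mat \<Rightarrow> 'a mat \<Rightarrow> 'a mat" where
  "kronecker A B =
     mat (dim_row A * dim_row B) (dim_col A * dim_col B)
       (\<lambda>(r, s). A $$ (r div dim_row B, s div dim_col B) * B $$ (r mod dim_row B, s mod dim_col B))"

end

theory Submission
  imports Defs
begin

text \<open>
  The hypothesis \<open>[K : k] = 2\<close> first has to be turned into \<open>K = k(i)\<close> with \<open>i \<notin> k\<close>. If \<open>i\<close> were in
  \<open>k\<close>, then \<open>K\<close> would be a quadratic extension of \<open>k\<close> by a square root or, in characteristic two,
  by a root of \<open>x\<^sup>2 + x = c\<close>, and expressing a further root of the same kind in the basis
  \<open>1, x\<close> would put \<open>x\<close> into \<open>k\<close>.

  For the similarities write \<open>R\<^bsub>\<lambda>\<^esub> = a + b E\<close> and \<open>R\<^bsub>\<mu>\<^esub> = c + d E\<close>. The matrices \<open>E \<otimes> 1\<close> and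
  \<open>1 \<otimes> E\<close> commute and agree up to sign on the two eigenspaces of the involution \<open>E \<otimes> E\<close>, where
  \<open>R\<^bsub>\<lambda>\<^esub> \<otimes> R\<^bsub>\<mu>\<^esub>\<close> becomes \<open>R\<close> of \<open>\<lambda>\<mu>\<close> and of \<open>\<lambda>\<^sup>*\<mu>\<close>, where \<open>\<lambda>\<^sup>*\<close> is the conjugate. Hence one
  constant base change serves all four cases: they differ only in which of the two blocks is scalar.
\<close>

section \<open>Quadratic algebraically closed extensions\<close>

lemma monic_quadratic_root_exists:
  fixes p q :: "'a::alg_closed_field"
  obtains y where "y ^ 2 + p * y + q = 0"
proof -
  have "\<exists>y. poly [:q, p, 1:] y = 0"
    by (rule alg_closed_imp_poly_has_root) simp
  then obtain y where "poly [:q, p, 1:] y = 0" ..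
  then have "y ^ 2 + p * y + q = 0"
    by (simp add: algebra_simps power2_eq_square)
  then show thesis by (rule that)
qed

lemma vector_space_scale_by:
  assumes "field_hom (emb :: 'k::field \<Rightarrow> 'K::field)"
  shows "vector_space (scale_by emb)"
proof -
  interpret field_hom emb by fact
  show ?thesis
    by unfold_locales (simp_all add: scale_by_def hom_distribs algebra_simps)
qed

text \<open>Since the dimension is two, extending the independent set \<open>{1}\<close> to a basis
  adds exactly one vector; it lies outside \<open>range emb\<close>, which is the span of
  \<open>1\<close>.\<close>

lemma real_closed_basis:
  fixes emb :: "'k::field \<Rightarrow> 'K::alg_closed_field"
  assumes "real_closed_with_closure emb"
  obtains x where "x \<notin> range emb" "\<And>z. \<exists>p q. z = emb p + emb q * x"
proof -
  have hom: "field_hom emb" and dim: "vector_space.dim (scale_by emb) UNIV = 2"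
    using assms by (auto simp: real_closed_with_closure_def is_algebraic_closure_def)
  interpret field_hom emb by fact
  interpret V: vector_space "scale_by emb" by (rule vector_space_scale_by[OF hom])
  define B where "B = V.extend_basis {1 :: 'K}"
  have "V.independent {1 :: 'K}" by simp
  then have B: "{1} \<subseteq> B" "V.independent B" "V.span B = UNIV"
    unfolding B_def
    by (fact V.extend_basis_superset V.independent_extend_basis V.span_extend_basis)+
  then have "card B = 2" using V.basis_card_eq_dim[of B UNIV] dim by auto
  then obtain x where x: "B = {1, x}" "x \<noteq> 1"
    using B(1) by (auto simp: card_2_iff)
  have "x \<notin> range emb"
  proof
    assume "x \<in> range emb"
    then have "x \<in> V.span {1}" by (auto simp: V.span_singleton scale_by_def)
    moreover have "B - {x} = {1}" using x by auto
    ultimately show False using B(2) x(1) unfolding V.dependent_def by auto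
  qed
  moreover have "\<exists>p q. z = emb p + emb q * x" for z
  proof -
    have "z \<in> V.span (insert x {1})" using B(3) x(1) by (simp add: insert_commute)
    then obtain q where "z - scale_by emb q x \<in> V.span {1}"
      unfolding V.span_breakdown_eq[of z x] by blast
    then obtain p where "z - emb q * x = emb p"
      unfolding V.span_singleton scale_by_def by auto
    then have "z = emb p + emb q * x" by (simp add: algebra_simps)
    then show ?thesis by blast
  qed
  ultimately show thesis by (rule that)
qed

text \<open>Coordinates in the basis \<open>1\<close>, \<open>x\<close> stand in for dimension two.
  The generator \<open>x\<close> stays a parameter because later proofs pass to better adapted
  generators.\<close>

locale quadratic_basis = field_hom emb
  for emb :: "'k::field \<Rightarrow> 'K::field" +
  fixes x :: 'K
  assumes notin: "x \<notin> range emb"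
    and ex_coords: "\<exists>p q. z = emb p + emb q * x"
begin

lemma coords_zero:
  assumes "emb p + emb q * x = 0"
  shows "p = 0 \<and> q = 0"
proof -
  have "q = 0"
  proof (rule ccontr)
    assume q: "q \<noteq> 0"
    then have "x = emb (- p / q)"
      using assms by (simp add: hom_distribs field_simps eq_neg_iff_add_eq_0)
    then show False using notin by blast
  qed
  then show ?thesis using assms by simp
qed

lemma coords_eq_iff: "emb p + emb q * x = emb p' + emb q' * x \<longleftrightarrow> p = p' \<and> q = q'"
proof
  assume "emb p + emb q * x = emb p' + emb q' * x"
  then have "emb (p - p') + emb (q - q') * x = 0"
    by (simp add: hom_distribs algebra_simps)
  from coords_zero[OF this] show "p = p' \<and> q = q'" by simp
qed auto

lemma in_range_iff: "emb p + emb q * x \<in> range emb \<longleftrightarrow> q = 0"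
proof
  assume "emb p + emb q * x \<in> range emb"
  then obtain r where "emb p + emb q * x = emb r + emb 0 * x" by auto
  then show "q = 0" by (simp only: coords_eq_iff)
qed auto

text \<open>An element outside \<open>range emb\<close> has non-zero coefficient at
  \<open>x\<close>, so \<open>x\<close> can be solved for in terms of it.\<close>

lemma change_basis:
  assumes "y \<notin> range emb"
  shows "quadratic_basis emb y"
proof
  obtain p q where y: "y = emb p + emb q * x" using ex_coords by blast
  then have q: "q \<noteq> 0" using assms by auto
  then have x: "x = emb (1 / q) * y - emb (p / q)"
    using y by (simp add: hom_distribs field_simps)
  fix z
  obtain r s where "z = emb r + emb s * x" using ex_coords by blast
  then have "z = emb (r - s * p / q) + emb (s / q) * y"
    by (simp add: x hom_distribs algebra_simps)
  then show "\<exists>p q. z = emb p + emb q * y" by blast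
qed fact

end

lemma quadratic_closure_char_not_2:
  fixes emb :: "'k::field \<Rightarrow> 'K::alg_closed_field"
  assumes "quadratic_basis emb x"
  shows "(2 :: 'k) \<noteq> 0"
proof
  interpret quadratic_basis emb x by fact
  assume two: "(2 :: 'k) = 0"
  have "emb 2 = 2" using hom_add[of 1 1] by simp
  then have two': "(2 :: 'K) = 0" using two by simp
  have dbl': "u + u = 0" for u :: 'K using two' by (simp flip: mult_2)
  have sq: "(u + v) ^ 2 = u ^ 2 + v ^ 2" for u v :: 'K
    using two' by (simp add: power2_sum)
  obtain c b where x2: "x ^ 2 = emb c + emb b * x" using ex_coords by blast
  show False
  proof (cases "b = 0")
    case True
    \<comment> \<open>Squaring is additive here and \<open>x ^ 2\<close> lies in
      \<open>range emb\<close>, so every square does; a square root of \<open>x\<close> is therefore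
      impossible.\<close>
    obtain y where "y ^ 2 + 0 * y + (- x) = 0" by (rule monic_quadratic_root_exists)
    then have y: "y ^ 2 = x" by simp
    obtain p q where "y = emb p + emb q * x" using ex_coords by blast
    then have "x = emb (p ^ 2 + q ^ 2 * c)"
      using y by (simp add: sq hom_distribs power_mult_distrib x2 True)
    then show False using notin by blast
  next
    case False
    \<comment> \<open>Rescaling by \<open>b\<close> brings the equation of \<open>x\<close> into
      Artin-Schreier form \<open>w ^ 2 = emb e + w\<close>.\<close>
    define w where "w = x * emb (1 / b)"
    define e where "e = c / b ^ 2"
    have "w \<notin> range emb"
    proof
      assume "w \<in> range emb"
      then obtain r where "w = emb r" by blast
      then have "x = emb (r * b)" using False by (simp add: w_def hom_distribs field_simps)
      then show False using notin by blast
    qed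
    then interpret w: quadratic_basis emb w by (rule change_basis)
    have w2: "w ^ 2 = emb e + w"
      using False
      by (simp add: w_def e_def hom_distribs power_mult_distrib power_divide x2 add_divide_distrib)
        (simp add: power2_eq_square)
    \<comment> \<open>The right-hand side \<open>emb e * w\<close> is chosen so that comparing
      coefficients at \<open>w\<close> gives a root \<open>q\<close> of the equation of
      \<open>w\<close> in the smaller field. The roots of that equation are \<open>q\<close> and
      \<open>q + 1\<close>, so \<open>w\<close> is one of them.\<close>
    obtain y where "y ^ 2 + 1 * y + (- (emb e * w)) = 0" by (rule monic_quadratic_root_exists)
    then have y: "y ^ 2 + y = emb e * w" by simp
    obtain p q where pq: "y = emb p + emb q * w" using w.ex_coords by blast
    have "emb (p ^ 2 + q ^ 2 * e + p) + emb (q ^ 2 + q) * w = emb 0 + emb e * w"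
      using y by (simp add: pq sq power_mult_distrib w2 hom_distribs algebra_simps)
    then have "q ^ 2 + q = e" by (simp only: w.coords_eq_iff)
    then have "(w - emb q) * (w - emb (q + 1)) = w ^ 2 + emb e - w - 2 * emb q * w"
      by (simp add: hom_distribs algebra_simps power2_eq_square flip: \<open>q ^ 2 + q = e\<close>)
    also have "\<dots> = 0" by (simp add: w2 two' dbl')
    finally have "w = emb q \<or> w = emb (q + 1)" by simp
    then show False using w.notin by blast
  qed
qed

lemma quadratic_closure_i_notin:
  fixes emb :: "'k::field \<Rightarrow> 'K::alg_closed_field"
  assumes "quadratic_basis emb x" and i: "i ^ 2 = - 1"
  shows "i \<notin> range emb"
proof
  interpret quadratic_basis emb x by fact
  have two: "(2 :: 'k) \<noteq> 0" using quadratic_closure_char_not_2[OF assms(1)] .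
  have emb2: "emb 2 = 2" using hom_add[of 1 1] by simp
  have two': "(2 :: 'K) \<noteq> 0" using two emb2 hom_0_iff by metis
  assume "i \<in> range emb"
  then obtain j where ij: "i = emb j" by blast
  obtain c b where x2: "x ^ 2 = emb c + emb b * x" using ex_coords by blast
  \<comment> \<open>Completing the square: \<open>w\<close> generates and its square
    \<open>a\<close> lies in the smaller field.\<close>
  define w where "w = 2 * x - emb b"
  define a where "a = 4 * c + b ^ 2"
  have "w \<notin> range emb"
  proof
    assume "w \<in> range emb"
    then obtain r where "w = emb r" by blast
    then have "x = emb ((r + b) / 2)"
      using two' by (simp add: w_def hom_distribs emb2 field_simps)
    then show False using notin by blast
  qed
  then interpret w: quadratic_basis emb w by (rule change_basis)
  have "emb 4 = 4" using hom_add[of 2 2] emb2 by simp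
  moreover have "w ^ 2 = 4 * x ^ 2 - 4 * emb b * x + emb b ^ 2"
    by (simp add: w_def power2_eq_square algebra_simps)
  ultimately have w2: "w ^ 2 = emb a"
    by (simp add: x2 a_def hom_distribs algebra_simps)
  \<comment> \<open>The coordinates of a square root of \<open>w\<close> exhibit \<open>a\<close> as
    minus a square; with \<open>j ^ 2 = - 1\<close> it becomes a square, which forces
    \<open>w\<close> into \<open>range emb\<close>.\<close>
  obtain y where "y ^ 2 + 0 * y + (- w) = 0" by (rule monic_quadratic_root_exists)
  then have y: "y ^ 2 = w" by simp
  obtain p q where pq: "y = emb p + emb q * w" using w.ex_coords by blast
  have "y ^ 2 = emb p ^ 2 + emb q ^ 2 * w ^ 2 + 2 * emb p * emb q * w"
    by (simp add: pq power2_eq_square algebra_simps)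
  then have "emb (p ^ 2 + q ^ 2 * a) + emb (2 * p * q) * w = emb 0 + emb 1 * w"
    using y by (simp add: w2 hom_distribs emb2)
  then have 1: "p ^ 2 + q ^ 2 * a = 0" "2 * p * q = 1" by (simp_all only: w.coords_eq_iff)
  then have q: "q \<noteq> 0" by auto
  have "j ^ 2 = -1" using i by (metis ij hom_power hom_uminus hom_one injectivity)
  moreover have "a * q ^ 2 = - (p ^ 2)"
    using 1(1) by (simp add: eq_neg_iff_add_eq_0 algebra_simps)
  then have "a = - (p ^ 2) / q ^ 2"
    using q by (metis nonzero_eq_divide_eq power_not_zero)
  ultimately have "a = (j * p / q) ^ 2"
    by (simp add: power_mult_distrib power_divide)
  then have "w ^ 2 = emb (j * p / q) ^ 2" by (simp add: w2 hom_distribs)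
  then have "w = emb (j * p / q) \<or> w = emb (- (j * p / q))"
    unfolding power2_eq_iff hom_uminus .
  then show False using w.notin by blast
qed

section \<open>Coordinates and conjugation\<close>

definition rot_mat :: "'a::uminus \<Rightarrow> 'a \<Rightarrow> 'a mat" where
  "rot_mat a b = mat_of_rows_list 2 [[a, - b], [b, a]]"

definition scalar_mat1 :: "'a \<Rightarrow> 'a mat" where
  "scalar_mat1 a = mat_of_rows_list 1 [[a]]"

locale imaginary_quadratic = quadratic_basis emb i
  for emb :: "'k::field \<Rightarrow> 'K::field" and i +
  assumes i_squared: "i ^ 2 = - 1"
begin

lemma i_mult_i: "i * i = - 1" "i * (i * z) = - z"
  using i_squared by (simp_all add: power2_eq_square flip: mult.assoc)

text \<open>In characteristic two \<open>i ^ 2 = 1\<close>, which would make \<open>i\<close> equal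
  to \<open>1\<close> or \<open>- 1\<close>.\<close>

lemma two_neq_0: "(2 :: 'k) \<noteq> 0"
proof
  assume "(2 :: 'k) = 0"
  then have "emb 1 = emb (- 1)" by (metis one_add_one add_eq_0_iff)
  then have "i ^ 2 = 1 ^ 2" using i_squared by (simp add: hom_uminus)
  then have "i = emb 1 \<or> i = emb (- 1)" unfolding power2_eq_iff by (simp add: hom_uminus)
  then show False using notin by blast
qed

lemma R_mat_eq: "R_mat emb i (emb a + emb b * i) = rot_mat a b"
proof -
  have "(THE (a', b'). emb a + emb b * i = emb a' + emb b' * i) = (a, b)"
    by (rule the_equality) (auto simp: coords_eq_iff)
  then show ?thesis by (simp add: R_mat_def rot_mat_def)
qed

lemma J_mat_eq: "J_mat emb (emb a) = scalar_mat1 a"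
  by (simp add: J_mat_def scalar_mat1_def inv_into_f_f inj_f)

lemma mult_coords:
  "(emb a + emb b * i) * (emb c + emb d * i) = emb (a * c - b * d) + emb (a * d + b * c) * i"
  by (simp add: hom_distribs algebra_simps i_mult_i)

definition conj :: "'K \<Rightarrow> 'K" where
  "conj z = (THE z'. \<exists>a b. z = emb a + emb b * i \<and> z' = emb a + emb (- b) * i)"

lemma conj_coords: "conj (emb a + emb b * i) = emb a + emb (- b) * i"
  unfolding conj_def by (rule the_equality) (auto simp: coords_eq_iff)

lemma conj_automorphism: "automorphism_over emb conj"
proof -
  have real: "conj (emb a) = emb a" for a
    using conj_coords[of a 0] by simp
  have invol: "conj (conj z) = z" for z
    using ex_coords[of z] by (auto simp: conj_coords)
  have "bij conj" by (rule involuntory_imp_bij) (rule invol)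
  moreover have "field_hom conj"
  proof
    show "conj 0 = 0" "conj 1 = 1" using real[of 0] real[of 1] by simp_all
    fix u v
    obtain a b c d where uv: "u = emb a + emb b * i" "v = emb c + emb d * i"
      using ex_coords by metis
    have "u + v = emb (a + c) + emb (b + d) * i"
      by (simp add: uv hom_distribs algebra_simps)
    then show "conj (u + v) = conj u + conj v"
      by (simp only: uv conj_coords) (simp add: hom_distribs algebra_simps)
    show "conj (u * v) = conj u * conj v"
      by (simp add: uv mult_coords conj_coords)
  qed
  ultimately show ?thesis by (simp add: automorphism_over_def real)
qed

lemma i_neq_conj_i: "conj i \<noteq> i"
proof -
  have "emb 0 + emb (- 1) * i \<noteq> emb 0 + emb 1 * i"
    unfolding coords_eq_iff using two_neq_0 by (metis add_eq_0_iff one_add_one)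
  then show ?thesis using conj_coords[of 0 1] by simp
qed

text \<open>An automorphism over the smaller field is determined by the image of \<open>i\<close>,
  which is again a square root of \<open>- 1\<close>; the image \<open>i\<close> gives the identity
  and \<open>- i\<close> gives \<open>conj\<close>.\<close>

lemma conj_over_eq: "conj_over emb = conj"
  unfolding conj_over_def
proof (rule the_equality)
  show "automorphism_over emb conj \<and> conj \<noteq> id"
    using conj_automorphism i_neq_conj_i by auto
  fix \<sigma> assume \<sigma>: "automorphism_over emb \<sigma> \<and> \<sigma> \<noteq> id"
  then interpret s: field_hom \<sigma> by (simp add: automorphism_over_def)
  have fix_emb: "\<sigma> (emb a) = emb a" for a using \<sigma> by (simp add: automorphism_over_def)
  have coords: "\<sigma> (emb a + emb b * i) = emb a + emb b * \<sigma> i" for a b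
    by (simp add: s.hom_add s.hom_mult fix_emb)
  have "\<sigma> i ^ 2 = i ^ 2"
    by (simp add: i_squared s.hom_uminus flip: s.hom_power)
  then have "\<sigma> i = i \<or> \<sigma> i = - i" by (simp add: power2_eq_iff)
  moreover have "\<sigma> i \<noteq> i"
  proof
    assume "\<sigma> i = i"
    then have "\<sigma> z = z" for z using ex_coords[of z] by (auto simp: coords)
    then show False using \<sigma> by auto
  qed
  ultimately have "\<sigma> i = - i" by simp
  then show "\<sigma> = conj"
    using ex_coords by (metis (no_types) ext coords conj_coords hom_uminus
        mult_minus_left mult_minus_right)
qed

lemma in_imag_iff: "emb a + emb b * i \<in> module.span (scale_by emb) {i} \<longleftrightarrow> a = 0"
proof -
  interpret V: vector_space "scale_by emb"
    by (rule vector_space_scale_by) unfold_locales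
  have "emb a + emb b * i \<in> V.span {i} \<longleftrightarrow> (\<exists>r. emb a + emb b * i = emb 0 + emb r * i)"
    by (auto simp: V.span_singleton scale_by_def)
  also have "\<dots> \<longleftrightarrow> a = 0" unfolding coords_eq_iff by auto
  finally show ?thesis .
qed

end

section \<open>Kronecker products of rotation-scaling matrices\<close>

lemma less_2_cases: "n < 2 \<longleftrightarrow> n = 0 \<or> n = (1::nat)" by auto

lemma less_4_cases: "n < 4 \<longleftrightarrow> n = 0 \<or> n = 1 \<or> n = 2 \<or> n = (3::nat)" by auto

text \<open>Once \<open>list_all\<close> is unfolded, the last premise is a conjunction of sixteen
  equations at literal indices, which simplification can evaluate.\<close>

lemma mat4_eqI_list_all:
  assumes "dim_row A = 4" "dim_col A = 4" "dim_row B = 4" "dim_col B = 4"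
    and "list_all (\<lambda>r. list_all (\<lambda>s. A $$ (r, s) = B $$ (r, s)) [0, 1, 2, 3]) [0, 1, 2, 3]"
  shows "A = B"
  by (rule eq_matI) (use assms in \<open>auto simp: less_4_cases\<close>)

lemmas mat4_eqI = mat4_eqI_list_all
  [unfolded list.pred_inject list.pred_inject(1)[THEN eqTrueI] simp_thms]

lemma atLeast0LessThan_4: "{0..<4} = {0, 1, 2, 3 :: nat}"
  by auto

lemma mat4_carrier [simp]:
  "mat_of_rows_list 4 [u, v, w, x] \<in> carrier_mat 4 4"
  "dim_row (mat_of_rows_list 4 [u, v, w, x]) = 4" "dim_col (mat_of_rows_list 4 [u, v, w, x]) = 4"
  by (rule carrier_matI) (simp_all add: mat_of_rows_list_def)

lemma mat4_index [simp]:
  "i < 4 \<Longrightarrow> j < 4 \<Longrightarrow>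
    mat_of_rows_list 4 [u, v, w, x] $$ (i, j) = [u, v, w, x] ! i ! j"
  by (simp add: mat_of_rows_list_def)

lemma rot_mat_carrier [simp]:
  "rot_mat a b \<in> carrier_mat 2 2" "dim_row (rot_mat a b) = 2" "dim_col (rot_mat a b) = 2"
  by (rule carrier_matI) (simp_all add: rot_mat_def mat_of_rows_list_def)

lemma rot_mat_index [simp]:
  "rot_mat a b $$ (0, 0) = a" "rot_mat a b $$ (0, Suc 0) = - b"
  "rot_mat a b $$ (Suc 0, 0) = b" "rot_mat a b $$ (Suc 0, Suc 0) = a"
  by (simp_all add: rot_mat_def mat_of_rows_list_def)

lemma scalar_mat1_carrier [simp]:
  "scalar_mat1 a \<in> carrier_mat 1 1" "dim_row (scalar_mat1 a) = 1" "dim_col (scalar_mat1 a) = 1"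
  by (rule carrier_matI) (simp_all add: scalar_mat1_def mat_of_rows_list_def)

lemma scalar_mat1_index [simp]: "scalar_mat1 a $$ (0, 0) = a"
  by (simp add: scalar_mat1_def mat_of_rows_list_def)

text \<open>Lets a pair of equal \<open>J\<close> blocks be treated as a degenerate rotation
  block.\<close>

lemma rot_mat_0: "rot_mat (a::'a::ring) 0 = diag_block_mat (replicate 2 (scalar_mat1 a))"
  by (rule eq_matI) (auto simp: less_2_cases Let_def numeral_2_eq_2 less_Suc_eq)

lemma kronecker_scalar: "kronecker (scalar_mat1 a) (scalar_mat1 b) = scalar_mat1 (a * b)"
  by (rule eq_matI) (auto simp: kronecker_def)

lemma kronecker_scalar_rot:
  "kronecker (scalar_mat1 (a::'a::ring)) (rot_mat c d) = rot_mat (a * c) (a * d)"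
  by (rule eq_matI) (auto simp: kronecker_def less_2_cases)

lemma kronecker_rot_rot:
  "kronecker (rot_mat a b) (rot_mat c (d::'a::comm_ring)) = mat_of_rows_list 4
     [[a * c, - (a * d), - (b * c), b * d],
      [a * d, a * c, - (b * d), - (b * c)],
      [b * c, - (b * d), a * c, - (a * d)],
      [b * d, b * c, a * d, a * c]]"
  by (rule mat4_eqI) (simp_all add: kronecker_def)

lemma diag_block_rot_rot:
  "diag_block_mat [rot_mat a b, rot_mat c (d::'a::ring)] = mat_of_rows_list 4
     [[a, - b, 0, 0], [b, a, 0, 0], [0, 0, c, - d], [0, 0, d, c]]"
  by (rule mat4_eqI) (simp_all add: Let_def)

text \<open>As a rewrite rule this keeps products of literal matrices literal.\<close>

lemma mat4_mult:
  "mat_of_rows_list 4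
     [[a0, a1, a2, a3],
      [b0, b1, b2, b3],
      [c0, c1, c2, c3],
      [d0, d1, d2, d3]] *
   mat_of_rows_list 4
     [[p0, p1, p2, p3],
      [q0, q1, q2, q3],
      [r0, r1, r2, r3],
      [s0, s1, s2, s3]] =
   mat_of_rows_list 4
     [[a0 * p0 + a1 * q0 + a2 * r0 + a3 * s0, a0 * p1 + a1 * q1 + a2 * r1 + a3 * s1,
       a0 * p2 + a1 * q2 + a2 * r2 + a3 * s2, a0 * p3 + a1 * q3 + a2 * r3 + a3 * s3],
      [b0 * p0 + b1 * q0 + b2 * r0 + b3 * s0, b0 * p1 + b1 * q1 + b2 * r1 + b3 * s1,
       b0 * p2 + b1 * q2 + b2 * r2 + b3 * s2, b0 * p3 + b1 * q3 + b2 * r3 + b3 * s3],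
      [c0 * p0 + c1 * q0 + c2 * r0 + c3 * s0, c0 * p1 + c1 * q1 + c2 * r1 + c3 * s1,
       c0 * p2 + c1 * q2 + c2 * r2 + c3 * s2, c0 * p3 + c1 * q3 + c2 * r3 + c3 * s3],
      [d0 * p0 + d1 * q0 + d2 * r0 + d3 * s0, d0 * p1 + d1 * q1 + d2 * r1 + d3 * s1,
       d0 * p2 + d1 * q2 + d2 * r2 + d3 * s2, d0 * p3 + d1 * q3 + d2 * r3 + d3 * s3]]"
  for a0 :: "'a::comm_ring"
  by (rule mat4_eqI) (simp_all add: scalar_prod_def atLeast0LessThan_4 add.assoc)

lemma one_mat4:
  "1\<^sub>m 4 = mat_of_rows_list 4 [[1, 0, 0, 0], [0, 1, 0, 0], [0, 0, 1, 0], [0, 0, 0, 1]]"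
  by (rule mat4_eqI) simp_all

text \<open>Multiplying \<open>A * P = P * B\<close> by \<open>Q\<close> from the right gives the
  similarity; only products of two matrices have to be computed.\<close>

lemma similar_mat_intertwineI:
  assumes "A \<in> carrier_mat n n" "B \<in> carrier_mat n n" "P \<in> carrier_mat n n" "Q \<in> carrier_mat n n"
    and "P * Q = 1\<^sub>m n" "Q * P = 1\<^sub>m n" "A * P = P * B"
  shows "similar_mat A B"
proof (rule similar_matI)
  have "A = A * (P * Q)" using assms by simp
  also have "\<dots> = A * P * Q" using assms(1,3,4) by (simp add: assoc_mult_mat)
  finally show "A = P * B * Q" using assms(7) by simp
qed (use assms in auto)

text \<open>Both orders of the two blocks are provided, so that a block that becomes scalar can be
  placed first.\<close>

lemma similar_kronecker_rot:
  fixes a b c d :: "'a::field"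
  assumes two: "(2 :: 'a) \<noteq> 0"
  shows "similar_mat (kronecker (rot_mat a b) (rot_mat c d))
           (diag_block_mat [rot_mat (a * c - b * d) (a * d + b * c),
                            rot_mat (a * c + b * d) (a * d - b * c)])" (is ?first)
    and "similar_mat (kronecker (rot_mat a b) (rot_mat c d))
           (diag_block_mat [rot_mat (a * c + b * d) (a * d - b * c),
                            rot_mat (a * c - b * d) (a * d + b * c)])" (is ?second)
proof -
  \<comment> \<open>The columns of each \<open>P\<close> below are orthogonal with sum of squares
    \<open>2\<close>, so its inverse \<open>Q\<close> is \<open>h\<close> times the
    transpose.\<close>
  define h where "h = 1 / (2 :: 'a)"
  have h: "h + h = 1" using two by (simp add: h_def flip: mult_2)
  txt \<open>
    The columns of \<open>P\<close> are \<open>v, (1 \<otimes> E) v\<close> for an eigenvector \<open>v = e\<^sub>0 \<otimes> e\<^sub>0 \<mp> e\<^sub>1 \<otimes> e\<^sub>1\<close> of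
    \<open>E \<otimes> E\<close> to the eigenvalue \<open>\<mp>1\<close>.
  \<close>
  show ?first
    unfolding kronecker_rot_rot diag_block_rot_rot
    by (rule similar_mat_intertwineI[where n = 4 and
          P = "mat_of_rows_list 4 [[1, 0, 1, 0], [0, 1, 0, 1], [0, 1, 0, - 1], [- 1, 0, 1, 0]]" and
          Q = "mat_of_rows_list 4 [[h, 0, 0, - h], [0, h, h, 0], [h, 0, 0, h], [0, h, - h, 0]]"])
      (simp_all add: mat4_mult one_mat4 h algebra_simps)
  show ?second
    unfolding kronecker_rot_rot diag_block_rot_rot
    by (rule similar_mat_intertwineI[where n = 4 and
          P = "mat_of_rows_list 4 [[1, 0, 1, 0], [0, 1, 0, 1], [0, - 1, 0, 1], [1, 0, - 1, 0]]" and
          Q = "mat_of_rows_list 4 [[h, 0, 0, h], [0, h, - h, 0], [h, 0, 0, - h], [0, h, h, 0]]"])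
      (simp_all add: mat4_mult one_mat4 h algebra_simps)
qed

section \<open>The six formulae, read off in coordinates\<close>

theorem theorem6:
  fixes emb :: "'k::field \<Rightarrow> 'K::alg_closed_field"
    and i l m :: 'K
  assumes real_closed: "real_closed_with_closure emb"
    and i: "i ^ 2 = - 1"
    and nonzero: "l \<noteq> 0" "m \<noteq> 0"
  defines "k \<equiv> range emb"
    and "bar \<equiv> conj_over emb"
    and "J \<equiv> J_mat emb"
    and "R \<equiv> R_mat emb i"
    and "imag \<equiv> module.span (scale_by emb) {i}"
  shows
    "(l \<in> k \<and> m \<in> k \<longrightarrow>
        l * m \<in> k \<and>
        similar_mat (kronecker (J l) (J m)) (J (l * m)))
   \<and> (l \<in> k \<and> m \<notin> k \<longrightarrow>
        l * m \<notin> k \<and>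
        similar_mat (kronecker (J l) (R m)) (R (l * m)))
   \<and> (l \<notin> k \<and> m \<notin> k \<longrightarrow>
        (l \<in> imag \<and> m \<in> imag \<longrightarrow>
           l * m \<in> k \<and> - (l * m) \<in> k \<and>
           similar_mat (kronecker (R l) (R m))
             (diag_block_mat (replicate 2 (J (l * m)) @ replicate 2 (J (- (l * m))))))
      \<and> (l \<notin> imag \<and> m \<notin> imag \<and> (\<exists>r. bar l = emb r * m) \<longrightarrow>
           l * m \<in> k \<and> bar l * m \<notin> k \<and>
           similar_mat (kronecker (R l) (R m))
             (diag_block_mat (replicate 2 (J (l * m)) @ [R (bar l * m)])))
      \<and> (l \<notin> imag \<and> m \<notin> imag \<and> (\<exists>r. l = emb r * m) \<longrightarrow>
           bar l * m \<in> k \<and> l * m \<notin> k \<and>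
           similar_mat (kronecker (R l) (R m))
             (diag_block_mat (replicate 2 (J (bar l * m)) @ [R (l * m)])))
      \<and> (\<not> (l \<in> imag \<and> m \<in> imag)
         \<and> \<not> (l \<notin> imag \<and> m \<notin> imag \<and> (\<exists>r. bar l = emb r * m))
         \<and> \<not> (l \<notin> imag \<and> m \<notin> imag \<and> (\<exists>r. l = emb r * m)) \<longrightarrow>
           l * m \<notin> k \<and> bar l * m \<notin> k \<and>
           similar_mat (kronecker (R l) (R m))
             (diag_block_mat [R (l * m), R (bar l * m)])))"
proof -
  obtain x where "x \<notin> range emb" "\<And>z. \<exists>p q. z = emb p + emb q * x"
    using real_closed_basis[OF real_closed] by blast
  moreover have "field_hom emb"
    using real_closed by (simp add: real_closed_with_closure_def is_algebraic_closure_def)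
  ultimately have qb: "quadratic_basis emb x"
    by (simp add: quadratic_basis_def quadratic_basis_axioms_def)
  have "quadratic_basis emb i"
    using quadratic_basis.change_basis[OF qb quadratic_closure_i_notin[OF qb i]] .
  with i interpret imaginary_quadratic emb i
    by (simp add: imaginary_quadratic_def imaginary_quadratic_axioms_def)
  obtain a b c d where lm: "l = emb a + emb b * i" "m = emb c + emb d * i"
    using ex_coords by metis
  have prod: "l * m = emb (a * c - b * d) + emb (a * d + b * c) * i"
    by (simp only: lm mult_coords)
  have bar_l: "bar l = emb a + emb (- b) * i"
    by (simp only: lm bar_def conj_over_eq conj_coords)
  have bar_prod: "bar l * m = emb (a * c + b * d) + emb (a * d - b * c) * i"
    unfolding bar_l unfolding lm mult_coords by simp
  have in_k: "l \<in> k \<longleftrightarrow> b = 0" "m \<in> k \<longleftrightarrow> d = 0"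
    "l * m \<in> k \<longleftrightarrow> a * d + b * c = 0" "bar l * m \<in> k \<longleftrightarrow> a * d - b * c = 0"
    unfolding k_def prod bar_prod unfolding lm by (simp_all only: in_range_iff)
  have in_imag: "l \<in> imag \<longleftrightarrow> a = 0" "m \<in> imag \<longleftrightarrow> c = 0"
    unfolding imag_def lm by (simp_all only: in_imag_iff)
  have R: "R l = rot_mat a b" "R m = rot_mat c d"
    "R (l * m) = rot_mat (a * c - b * d) (a * d + b * c)"
    "R (bar l * m) = rot_mat (a * c + b * d) (a * d - b * c)"
    unfolding R_def prod bar_prod unfolding lm by (simp_all only: R_mat_eq)
  have J: "b = 0 \<Longrightarrow> J l = scalar_mat1 a" "d = 0 \<Longrightarrow> J m = scalar_mat1 c"
    "a * d + b * c = 0 \<Longrightarrow> J (l * m) = scalar_mat1 (a * c - b * d)"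
    "a * d + b * c = 0 \<Longrightarrow> J (- (l * m)) = scalar_mat1 (b * d - a * c)"
    "a * d - b * c = 0 \<Longrightarrow> J (bar l * m) = scalar_mat1 (a * c + b * d)"
    unfolding J_def prod bar_prod unfolding lm
    by (simp_all add: J_mat_eq flip: hom_uminus)
  \<comment> \<open>Proportionality is the vanishing of a 2 by 2 determinant;
    \<open>c \<noteq> 0\<close> supplies the ratio \<open>a' / c\<close> as a witness.\<close>
  have multiple: "(\<exists>r. l = emb r * m) \<longleftrightarrow> a * d - b * c = 0"
    "(\<exists>r. bar l = emb r * m) \<longleftrightarrow> a * d + b * c = 0" if "c \<noteq> 0"
  proof -
    have r: "emb r * m = emb (r * c) + emb (r * d) * i" for r
      by (simp add: lm hom_distribs algebra_simps)
    have *: "(\<exists>r. a' = r * c \<and> b' = r * d) \<longleftrightarrow> a' * d - b' * c = 0" for a' b'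
    proof
      assume "a' * d - b' * c = 0"
      then show "\<exists>r. a' = r * c \<and> b' = r * d"
        using \<open>c \<noteq> 0\<close> by (intro exI[of _ "a' / c"]) (auto simp: field_simps)
    qed (auto simp: algebra_simps)
    show "(\<exists>r. l = emb r * m) \<longleftrightarrow> a * d - b * c = 0"
      unfolding r unfolding lm coords_eq_iff * ..
    show "(\<exists>r. bar l = emb r * m) \<longleftrightarrow> a * d + b * c = 0"
      unfolding r bar_l coords_eq_iff * by simp
  qed
  have neg_in_k: "- (l * m) \<in> k" if "l * m \<in> k"
    using that unfolding k_def by (auto simp flip: hom_uminus)
  have two_mult: "u + u = 0 \<longleftrightarrow> u = 0" for u :: 'k
    using two_neq_0 by (simp flip: mult_2)
  note sim = similar_kronecker_rot[OF two_neq_0, of a b c d]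
  have diag_scalar: "diag_block_mat (replicate 2 (scalar_mat1 u) @ Bs) =
      diag_block_mat (rot_mat u 0 # Bs)" for u :: 'k and Bs
    by (simp only: diag_block_mat_append rot_mat_0[symmetric] diag_block_mat.simps(2) Let_def)
  show ?thesis
  proof (intro conjI impI; (elim conjE)?)
    assume "l \<in> k" "m \<in> k"
    then have "b = 0" "d = 0" by (simp_all add: in_k)
    then show "l * m \<in> k" "similar_mat (kronecker (J l) (J m)) (J (l * m))"
      by (simp_all add: in_k J kronecker_scalar similar_mat_refl[OF scalar_mat1_carrier(1)])
  next
    assume "l \<in> k" "m \<notin> k"
    \<comment> \<open>This makes the imaginary coordinate \<open>a * d\<close> of
      \<open>l * m\<close> non-zero.\<close>
    moreover from this have "a \<noteq> 0" using nonzero(1) lm(1) in_k(1) by auto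
    ultimately show "l * m \<notin> k" "similar_mat (kronecker (J l) (R m)) (R (l * m))"
      by (simp_all add: in_k J R kronecker_scalar_rot similar_mat_refl[OF rot_mat_carrier(1)])
  next
    assume "l \<in> imag" "m \<in> imag"
    then have "a = 0" "c = 0" by (simp_all add: in_imag)
    then show "l * m \<in> k" "- (l * m) \<in> k"
      using neg_in_k by (simp_all add: in_k)
    \<comment> \<open>With \<open>a = c = 0\<close> both imaginary coordinates vanish, so both
      rotation blocks are scalar, with values \<open>- (b * d)\<close> and
      \<open>b * d\<close>.\<close>
    show "similar_mat (kronecker (R l) (R m))
        (diag_block_mat (replicate 2 (J (l * m)) @ replicate 2 (J (- (l * m)))))"
      using sim(1) diag_scalar[of _ "[]"] \<open>a = 0\<close> \<open>c = 0\<close> by (simp add: J R diag_scalar)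
  next
    assume "l \<notin> k" "m \<notin> k" "l \<notin> imag" "m \<notin> imag" "\<exists>r. bar l = emb r * m"
    then have nz: "b \<noteq> 0" "c \<noteq> 0" and eq: "a * d + b * c = 0"
      by (simp_all add: in_k in_imag multiple)
    \<comment> \<open>Otherwise sum and difference both vanish, giving
      \<open>2 * b * c = 0\<close>.\<close>
    have "a * d - b * c \<noteq> 0"
      using two_mult[of "b * c"] nz eq by (auto simp: add_eq_0_iff2)
    with eq show "l * m \<in> k" "bar l * m \<notin> k"
      by (simp_all add: in_k)
    show "similar_mat (kronecker (R l) (R m))
        (diag_block_mat (replicate 2 (J (l * m)) @ [R (bar l * m)]))"
      using sim(1) eq by (simp only: J R diag_scalar)
  next
    assume "l \<notin> k" "m \<notin> k" "l \<notin> imag" "m \<notin> imag" "\<exists>r. l = emb r * m"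
    then have nz: "b \<noteq> 0" "c \<noteq> 0" and eq: "a * d - b * c = 0"
      by (simp_all add: in_k in_imag multiple)
    have "a * d + b * c \<noteq> 0"
      using two_mult[of "b * c"] nz eq by auto
    with eq show "bar l * m \<in> k" "l * m \<notin> k"
      by (simp_all add: in_k)
    show "similar_mat (kronecker (R l) (R m))
        (diag_block_mat (replicate 2 (J (bar l * m)) @ [R (l * m)]))"
      using sim(2) eq by (simp only: J R diag_scalar)
  next
    assume "l \<notin> k" "m \<notin> k"
      and other: "\<not> (l \<in> imag \<and> m \<in> imag)"
        "\<not> (l \<notin> imag \<and> m \<notin> imag \<and> (\<exists>r. bar l = emb r * m))"
        "\<not> (l \<notin> imag \<and> m \<notin> imag \<and> (\<exists>r. l = emb r * m))"
    then have "b \<noteq> 0" "d \<noteq> 0" by (simp_all add: in_k)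
    \<comment> \<open>If \<open>c = 0\<close>, then \<open>a \<noteq> 0\<close> and both imaginary
      coordinates equal \<open>a * d\<close>. If \<open>c \<noteq> 0\<close>, a vanishing one gives
      proportionality by \<open>multiple\<close> and \<open>a \<noteq> 0\<close> from
      \<open>b * c \<noteq> 0\<close>, which is an excluded case.\<close>
    then show "l * m \<notin> k" "bar l * m \<notin> k"
      using other multiple by (cases "c = 0"; auto simp: in_k in_imag)+
    show "similar_mat (kronecker (R l) (R m)) (diag_block_mat [R (l * m), R (bar l * m)])"
      using sim(1) by (simp only: R)
  qed
qed

end
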